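(* Let $\varepsilon<\frac13$ be a positive real number, let $n\ge 0$ be an integer, and let $\theta_0,\dots,\theta_n\in\mathbb{R}$ be pairwise distinct angles (modulo $2\pi$). If the set $\bigcup_{j=0}^{n}R_{\theta_j}E_{\varepsilon}$ is periodic, then it does not cover the whole plane, i.e. $\bigcup_{j=0}^{n}R_{\theta_j}E_{\varepsilon}\neq\mathbb{R}^2$.
   Context: For real $x$, $\|x\|$ denotes the distance from $x$ to the nearest integer. For $\varepsilon>0$, $E_{\varepsilon}=\{(x,y)\in\mathbb{R}^2:\|x\|\le\varepsilon\}$. $R_{\theta}$ denotes the counterclockwise rotation of the plane $\mathbb{R}^2$ by angle $\theta$ around the origin. Put $\mathbf{u}_j=(\cos\theta_j,\sin\theta_j)\in\mathbb{R}^2$. Given $\theta_0,\dots,\theta_n$, a vector $\mathbf{v}\in\mathbb{R}^2$ is called a period-vector of $\bigcup_{j=0}^{n}R_{\theta_j}E_{\varepsilon}$ if $\langle\mathbf{u}_j,\mathbf{v}\rangle\in\mathbb{Z}$ for every $j=0,\dots,n$ (standard inner product). The set $\bigcup_{j=0}^{n}R_{\theta_j}E_{\varepsilon}$ is called periodic if it has two $\mathbb{R}$-linearly independent period-vectors in this sense. *)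

theory Defs
  imports "HOL-Analysis.Analysis" "HOL-Library.Real_Mod"
begin

definition dist_nearest_int :: "real \<Rightarrow> real" where
  "dist_nearest_int x = infdist x \<int>"

definition strips :: "real \<Rightarrow> (real ^ 2) set" where
  "strips \<epsilon> = {p. dist_nearest_int (p $ 1) \<le> \<epsilon>}"

definition rot :: "real \<Rightarrow> real ^ 2 \<Rightarrow> real ^ 2" where
  "rot t p = vector [cos t * p $ 1 - sin t * p $ 2, sin t * p $ 1 + cos t * p $ 2]"

definition unit_vec :: "real \<Rightarrow> real ^ 2" where
  "unit_vec t = vector [cos t, sin t]"

definition strips_union :: "nat \<Rightarrow> (nat \<Rightarrow> real) \<Rightarrow> real \<Rightarrow> (real ^ 2) set" where
  "strips_union n \<theta> \<epsilon> = (\<Union>j\<in>{0..n}. rot (\<theta> j) ` strips \<epsilon>)"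

(* A period-vector of strips_union n \<theta> \<epsilon> is defined through the angles \<theta> 0, ..., \<theta> n and not by
   translation invariance of the point set (which it implies), so \<epsilon> plays no role here. *)
definition period_vector :: "nat \<Rightarrow> (nat \<Rightarrow> real) \<Rightarrow> real ^ 2 \<Rightarrow> bool" where
  "period_vector n \<theta> v \<longleftrightarrow> (\<forall>j\<in>{0..n}. unit_vec (\<theta> j) \<bullet> v \<in> \<int>)"

(* The condition v \<noteq> w is needed because {v, w} collapses to a singleton when v = w. *)
definition periodic_strips :: "nat \<Rightarrow> (nat \<Rightarrow> real) \<Rightarrow> bool" where
  "periodic_strips n \<theta> \<longleftrightarrow>
     (\<exists>v w. period_vector n \<theta> v \<and> period_vector n \<theta> w \<and> v \<noteq> w \<and> independent {v, w})"

end

theory Submission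
  imports Defs "HOL-Computational_Algebra.Squarefree"
begin

text \<open>
  A point \<open>p\<close> avoids all strips iff every \<open>\<langle>u\<^sub>j, p\<rangle>\<close> has distance more than \<open>\<epsilon>\<close> from \<open>\<int>\<close>, so
  we look for \<open>p\<close> for which all these distances are at least \<open>1/3\<close>. If the \<open>u\<^sub>j\<close> span at most two
  lines, make all inner products \<open>\<plusminus>1/2\<close>. Otherwise, after rotating \<open>u\<^sub>0\<close> to \<open>(1, 0)\<close>,
  periodicity forces all \<open>u\<^sub>j\<close> to be norm-one elements \<open>a + b \<surd>-d\<close> of one imaginary
  quadratic field, with \<open>d\<close> squarefree. Such a field has a ramified prime \<open>\<pp>\<close>, and elements of norm
  one are \<open>\<plusminus>1\<close> modulo \<open>\<pp>\<close>. Concretely, for a prime \<open>p\<close> dividing \<open>d\<close>, the equation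
  \<open>a\<^sup>2 + d b\<^sup>2 = 1\<close> makes \<open>a\<close> integral at \<open>p\<close> and congruent to \<open>\<plusminus>1\<close>, so a suitable multiple of
  \<open>u\<^sub>0\<close> has inner products \<open>\<plusminus>\<lfloor>p/2\<rfloor>/p\<close> modulo 1. For \<open>d = 1\<close> the
  prime 2 plays this role, with \<open>a + b\<close> instead of \<open>a\<close>.
\<close>

section \<open>Denominators of rational points on a conic\<close>

lemma common_denominator:
  fixes A :: "real set"
  assumes "finite A" "A \<subseteq> \<rat>"
  shows "\<exists>M::nat. M > 0 \<and> (\<forall>x\<in>A. real M * x \<in> \<int>)"
  using assms
proof (induction A rule: finite_induct)
  case empty
  show ?case by (intro exI[of _ 1]) auto
next
  case (insert x A)
  then obtain M :: nat where M: "M > 0" "\<forall>y\<in>A. real M * y \<in> \<int>" by auto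
  from insert.prems obtain m k where x: "k > 0" "x = of_int m / of_int k"
    by (auto elim: Rats_cases')
  have "real (nat k * M) * y \<in> \<int>" if "y \<in> insert x A" for y
  proof (cases "y = x")
    case True
    have "real (nat k * M) * x = of_int (int M * m)"
      using x by (simp add: field_simps)
    then show ?thesis unfolding True by (metis Ints_of_int)
  next
    case False
    with that M have "real M * y \<in> \<int>" by auto
    moreover have "real (nat k * M) * y = of_int k * (real M * y)"
      using x by simp
    ultimately show ?thesis by (metis Ints_mult Ints_of_int)
  qed
  then show ?case using M x by (intro exI[of _ "nat k * M"]) auto
qed

text \<open>Integrality at \<open>p\<close>: the common denominator \<open>M\<close> is invertible
  modulo \<open>p\<close>. The hypothesis \<open>descent\<close> isolates the arithmetic input, so
  that primes dividing \<open>d\<close> and the prime 2 for \<open>d = 1\<close> share one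
  argument.\<close>

lemma common_denominator_coprime:
  fixes a b :: "'a \<Rightarrow> real" and p d :: nat
  assumes J: "finite J" and "p > 1"
    and descent: "\<And>x y M :: int. x^2 + int d * y^2 = M^2 \<Longrightarrow> int p dvd M \<Longrightarrow> int p dvd x \<and> int p dvd y"
    and rat: "\<And>j. j \<in> J \<Longrightarrow> a j \<in> \<rat> \<and> b j \<in> \<rat>"
    and eq: "\<And>j. j \<in> J \<Longrightarrow> a j ^ 2 + real d * b j ^ 2 = 1"
  obtains M :: int and x y :: "'a \<Rightarrow> int"
  where "\<not> int p dvd M"
    "\<And>j. j \<in> J \<Longrightarrow> of_int M * a j = of_int (x j) \<and> of_int M * b j = of_int (y j)"
    "\<And>j. j \<in> J \<Longrightarrow> x j ^ 2 + int d * y j ^ 2 = M ^ 2"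
proof -
  define P where "P M \<longleftrightarrow> M > 0 \<and> (\<forall>j\<in>J. real M * a j \<in> \<int> \<and> real M * b j \<in> \<int>)" for M :: nat
  have "\<exists>M. P M"
    using common_denominator[of "a ` J \<union> b ` J"] J rat unfolding P_def by blast
  \<comment> \<open>A minimal common denominator is prime to \<open>p\<close>, since otherwise \<open>descent\<close> divides out a factor \<open>p\<close>.\<close>
  then obtain M where M: "P M" "\<And>m. m < M \<Longrightarrow> \<not> P m"
    using exists_least_iff[of P] by blast
  have "\<forall>j\<in>J. \<exists>x y. real M * a j = of_int x \<and> real M * b j = of_int y"
    using M(1) unfolding P_def by (meson Ints_cases)
  then obtain x y where xy: "\<And>j. j \<in> J \<Longrightarrow> real M * a j = of_int (x j) \<and> real M * b j = of_int (y j)"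
    by metis
  have int_eq: "x j ^ 2 + int d * y j ^ 2 = (int M)^2" if "j \<in> J" for j
  proof -
    have "real_of_int (x j ^ 2 + int d * y j ^ 2) = (real M * a j)^2 + real d * (real M * b j)^2"
      using xy[OF that] by simp
    also have "\<dots> = (real M)^2 * (a j ^ 2 + real d * b j ^ 2)"
      by (simp add: algebra_simps power_mult_distrib)
    finally have "real_of_int (x j ^ 2 + int d * y j ^ 2) = real_of_int ((int M)^2)"
      using eq[OF that] by simp
    then show ?thesis by (simp only: of_int_eq_iff)
  qed
  have "\<not> int p dvd int M"
  proof
    assume dvd: "int p dvd int M"
    then obtain m where m: "M = p * m" by auto
    have "P m"
      unfolding P_def
    proof (intro conjI ballI)
      show "m > 0" using M(1) m by (auto simp: P_def intro: Nat.gr0I)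
    next
      fix j assume j: "j \<in> J"
      from descent[OF int_eq[OF j] dvd] obtain x' y' where "x j = int p * x'" "y j = int p * y'"
        by (auto elim!: dvdE)
      with xy[OF j] m \<open>p > 1\<close> have "real m * a j = of_int x'" "real m * b j = of_int y'"
        by auto
      then show "real m * a j \<in> \<int>" "real m * b j \<in> \<int>" by auto
    qed
    moreover have "m < M" using m M(1) \<open>p > 1\<close> by (auto simp: P_def)
    ultimately show False using M(2) by blast
  qed
  then show ?thesis using that[of "int M" x y] xy int_eq by auto
qed

text \<open>Modulo \<open>p\<close> the form reduces to \<open>x^2\<close>, so \<open>p\<close>
  divides \<open>x\<close>. Then \<open>p^2\<close> divides \<open>d * y^2\<close>, and
  \<open>p\<close> occurs only once in the squarefree \<open>d\<close>.\<close>

lemma prime_dvd_squarefree_form: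
  fixes x y M :: int and p d :: nat
  assumes "prime p" "squarefree d" "p dvd d" "x^2 + int d * y^2 = M^2" "int p dvd M"
  shows "int p dvd x \<and> int p dvd y"
proof -
  have p: "prime (int p)" using assms by simp
  obtain e where e: "d = p * e" using assms by auto
  have pe: "\<not> p dvd e"
  proof
    assume "p dvd e"
    then have "p^2 dvd d" using e by (auto simp: power2_eq_square)
    with assms(2) have "p dvd 1" unfolding squarefree_def by blast
    then show False using assms(1) by auto
  qed
  have "int p dvd M^2 - int d * y^2"
    using assms(5) e by (simp add: power2_eq_square)
  moreover have "x^2 = M^2 - int d * y^2" using assms(4) by simp
  ultimately have "int p dvd x^2" by simp
  then have px: "int p dvd x" using p prime_dvd_power by blast
  obtain x' m where "x = int p * x'" "M = int p * m" using px assms(5) by (auto elim!: dvdE)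
  then have "int p * (int e * y^2) = int p * (int p * (m^2 - x'^2))"
    using assms(4) e by (simp add: power2_eq_square algebra_simps)
  then have "int e * y^2 = int p * (m^2 - x'^2)"
    using p by (simp add: prime_gt_0_nat)
  then have "int p dvd int e * y^2" by simp
  then have "int p dvd y"
    using p pe by (metis int_dvd_int_iff prime_dvd_mult_iff prime_dvd_power)
  with px show ?thesis by blast
qed

text \<open>Squares are 0 or 1 modulo 4, so a sum of two squares divisible by 4 has two even
  bases.\<close>

lemma even_sum_squares:
  fixes x y M :: int
  assumes "x^2 + y^2 = M^2" "even M"
  shows "even x \<and> even y"
proof -
  have "4 dvd M^2" using assms(2) by (auto elim!: evenE simp: power2_eq_square)
  then have *: "(x^2 + y^2) mod 4 = 0" using assms(1) by simp
  have "z^2 mod 4 = (if even z then 0 else 1)" for z :: int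
  proof (cases "even z")
    case True
    then show ?thesis by (auto elim!: evenE simp: power2_eq_square)
  next
    case False
    then obtain b where "z = 2 * b + 1" by (auto elim: oddE)
    then have "z^2 = 1 + 4 * (b^2 + b)" by (simp add: power2_eq_square algebra_simps)
    then show ?thesis using False by presburger
  qed
  with * show ?thesis
    by (auto simp: mod_add_eq[of "x^2" 4 "y^2", symmetric] split: if_splits)
qed

section \<open>Linear forms modulo 1 on conics\<close>

text \<open>Modulo 1 the fraction is \<open>k / p\<close> or \<open>- k / p\<close>, and
  \<open>k / p\<close> lies between 1/3 and 2/3.\<close>

lemma fraction_far_from_int:
  fixes p k z i :: int
  assumes p: "p > 0" and k: "p \<le> 3 * k" "3 * k \<le> 2 * p" and z: "p dvd z - k \<or> p dvd z + k"
  shows "1/3 \<le> \<bar>of_int z / of_int p - (of_int i :: real)\<bar>"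
proof -
  have "p \<le> 3 * \<bar>z - i * p\<bar>"
  proof -
    from z obtain q where "z = p * q + k \<or> z = p * q - k"
      by (auto elim!: dvdE simp: algebra_simps) (metis add_diff_cancel diff_add_cancel)+
    then have "z - i * p = (q - i) * p + k \<or> z - i * p = (q - i) * p - k"
      by (auto simp: algebra_simps)
    then obtain m D where m: "D = m * p + k \<or> D = m * p - k" and D: "D = z - i * p" by blast
    consider "m \<ge> 1" | "m = 0" | "m \<le> -1" by linarith
    then show ?thesis
    proof cases
      case 1
      then have "p \<le> m * p" using p by simp
      then have "p \<le> 3 * D" using m p k by (elim disjE) linarith+
      then show ?thesis unfolding D[symmetric] by linarith
    next
      case 2
      with m k p show ?thesis unfolding D[symmetric] by auto
    next
      case 3
      then have "m * p \<le> - p" using p mult_right_mono[of m "-1" p] by simp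
      then have "p \<le> - 3 * D" using m p k by (elim disjE) linarith+
      then show ?thesis unfolding D[symmetric] by linarith
    qed
  qed
  then have "real_of_int p \<le> 3 * \<bar>of_int z - of_int i * of_int p\<bar>"
    by (metis (mono_tags) of_int_le_iff of_int_mult of_int_numeral of_int_abs of_int_diff)
  moreover have "of_int z / of_int p - (of_int i :: real) = (of_int z - of_int i * of_int p) / of_int p"
    using p by (simp add: field_simps)
  ultimately show ?thesis using p by (simp add: abs_divide field_simps)
qed

lemma squarefree_conic_character:
  fixes a b :: "'a \<Rightarrow> real" and d :: nat
  assumes J: "finite J" and d: "squarefree d"
    and rat: "\<And>j. j \<in> J \<Longrightarrow> a j \<in> \<rat> \<and> b j \<in> \<rat>"
    and eq: "\<And>j. j \<in> J \<Longrightarrow> a j ^ 2 + real d * b j ^ 2 = 1"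
  shows "\<exists>t s. \<forall>j\<in>J. \<forall>i::int. 1/3 \<le> \<bar>t * a j + s * b j - of_int i\<bar>"
proof (cases "d = 1")
  case True
  obtain M :: int and x y where M: "odd M"
    and xy: "\<And>j. j \<in> J \<Longrightarrow> of_int M * a j = of_int (x j) \<and> of_int M * b j = of_int (y j)"
    and sq: "\<And>j. j \<in> J \<Longrightarrow> x j ^ 2 + int d * y j ^ 2 = M ^ 2"
  proof (rule common_denominator_coprime[of J 2 d a b])
    show "int 2 dvd x \<and> int 2 dvd y" if "x^2 + int d * y^2 = M^2" "int 2 dvd M" for x y M :: int
      using that True even_sum_squares[of x y M] by simp
  qed (use J rat eq in auto)
  \<comment> \<open>The form takes the value \<open>(x j + y j) / 2\<close>, half an odd integer
    because \<open>M\<close> is odd.\<close>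
  have "1/3 \<le> \<bar>of_int M / 2 * a j + of_int M / 2 * b j - of_int i\<bar>" if j: "j \<in> J" for j and i :: int
  proof -
    have "odd (x j ^ 2 + y j ^ 2)" using sq[OF j] True M by simp
    then have "odd (x j + y j)" by simp
    then have "2 dvd (x j + y j) - 1" by presburger
    then have "1/3 \<le> \<bar>of_int (x j + y j) / of_int 2 - (of_int i :: real)\<bar>"
      by (intro fraction_far_from_int[of 2 1]) auto
    moreover have "of_int (x j + y j) / of_int 2 = of_int M / 2 * a j + of_int M / 2 * b j"
      using xy[OF j] by (simp add: add_divide_distrib)
    ultimately show ?thesis by (simp only:)
  qed
  then show ?thesis by blast
next
  case False
  then obtain p where p: "prime p" "p dvd d" using prime_factor_nat by blast
  obtain M :: int and x y where M: "\<not> int p dvd M"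
    and xy: "\<And>j. j \<in> J \<Longrightarrow> of_int M * a j = of_int (x j) \<and> of_int M * b j = of_int (y j)"
    and sq: "\<And>j. j \<in> J \<Longrightarrow> x j ^ 2 + int d * y j ^ 2 = M ^ 2"
  proof (rule common_denominator_coprime[of J p d a b])
    show "int p dvd x \<and> int p dvd y" if "x^2 + int d * y^2 = M^2" "int p dvd M" for x y M :: int
      using prime_dvd_squarefree_form[OF p(1) d p(2) that] .
  qed (use J rat eq prime_gt_1_nat[OF p(1)] in auto)
  have pp: "prime (int p)" using p by simp
  \<comment> \<open>The nearest choice to \<open>p / 2\<close>. The quotient \<open>k / p\<close> is
    smallest for \<open>p = 3\<close>, where it equals the bound 1/3.\<close>
  define k where "k = int p div 2"
  have "int p \<ge> 2" using p(1) prime_ge_2_nat by fastforce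
  then have k: "int p \<le> 3 * k" "3 * k \<le> 2 * int p" unfolding k_def by presburger+
  \<comment> \<open>\<open>r0\<close> inverts \<open>M\<close> modulo \<open>p\<close>, so
    multiplication by \<open>r0 * k\<close> sends \<open>M\<close> to \<open>k\<close> and hence
    every \<open>x j\<close> congruent to \<open>M\<close> or \<open>- M\<close> to \<open>k\<close>
    or \<open>- k\<close>.\<close>
  have "coprime M (int p)" using M pp by (metis coprime_commute prime_imp_coprime)
  then obtain r0 q where "r0 * M + q * int p = 1" using bezout_int[of M "int p"] by auto
  then have "(r0 * k) * M - k = int p * (- q * k)" by algebra
  then have r: "int p dvd (r0 * k) * M - k" by simp
  define r where "r = r0 * k"
  have "1/3 \<le> \<bar>of_int (r * M) / of_int (int p) * a j + 0 * b j - of_int i\<bar>" if j: "j \<in> J" for j and i :: int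
  proof -
    \<comment> \<open>Since \<open>p\<close> divides \<open>d\<close>, the conic reads
      \<open>x^2 = M^2\<close> modulo \<open>p\<close>, which has only the roots \<open>M\<close>
      and \<open>- M\<close>.\<close>
    have "int p dvd x j ^ 2 - M ^ 2"
      using sq[OF j] p(2) by (metis dvd_minus_iff dvd_mult2 int_dvd_int_iff add_diff_cancel_left' minus_diff_eq)
    then have "int p dvd (x j - M) * (x j + M)" by (simp add: power2_eq_square algebra_simps)
    then have "int p dvd x j - M \<or> int p dvd x j + M" using pp prime_dvd_mult_iff by blast
    then have "int p dvd r * x j - k \<or> int p dvd r * x j + k"
    proof
      assume "int p dvd x j - M"
      then have "int p dvd r * (x j - M) + (r * M - k)" using r unfolding r_def by (meson dvd_add dvd_mult)
      then show ?thesis by (simp add: algebra_simps)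
    next
      assume "int p dvd x j + M"
      then have "int p dvd r * (x j + M) - (r * M - k)" using r unfolding r_def by (meson dvd_diff dvd_mult)
      then show ?thesis by (simp add: algebra_simps)
    qed
    then have "1/3 \<le> \<bar>of_int (r * x j) / of_int (int p) - (of_int i :: real)\<bar>"
      using k \<open>int p \<ge> 2\<close> by (intro fraction_far_from_int[of "int p" k]) auto
    moreover have "of_int (r * x j) / of_int (int p) = of_int (r * M) / of_int (int p) * a j + 0 * b j"
      using xy[OF j] by simp
    ultimately show ?thesis by (simp only:)
  qed
  then show ?thesis by blast
qed

text \<open>A positive rational is a squarefree integer \<open>d\<close> times a rational square
  \<open>e^2\<close>; absorbing \<open>e\<close> into the second coordinate reduces to the
  squarefree case.\<close>

lemma rational_conic_character:
  fixes a b :: "'a \<Rightarrow> real"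
  assumes J: "finite J" and D: "D \<in> \<rat>" "D > 0"
    and rat: "\<And>j. j \<in> J \<Longrightarrow> a j \<in> \<rat> \<and> b j \<in> \<rat>"
    and eq: "\<And>j. j \<in> J \<Longrightarrow> a j ^ 2 + D * b j ^ 2 = 1"
  shows "\<exists>t s. \<forall>j\<in>J. \<forall>i::int. 1/3 \<le> \<bar>t * a j + s * b j - of_int i\<bar>"
proof -
  obtain A B :: nat where "B \<noteq> 0" and "\<bar>D\<bar> = real A / real B"
    using Rats_abs_nat_div_natE[OF D(1)] by metis
  then have AB: "D = real A / real B" "A > 0" "B > 0" using D(2) by (auto intro: Nat.gr0I)
  define d where "d = squarefree_part (A * B)"
  define q where "q = square_part (A * B)"
  have dq: "A * B = d * q^2" unfolding d_def q_def by (rule squarefree_decompose)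
  have d: "squarefree d" unfolding d_def using AB by simp
  have q: "q > 0" using dq AB by (auto intro: Nat.gr0I)
  define e where "e = real q / real B"
  have "D = real (A * B) / real B ^ 2" using AB by (simp add: power2_eq_square)
  then have De: "D = real d * e^2" by (simp add: dq e_def power_divide)
  have "\<exists>t s. \<forall>j\<in>J. \<forall>i::int. 1/3 \<le> \<bar>t * a j + s * (e * b j) - of_int i\<bar>"
  proof (rule squarefree_conic_character[OF J d])
    show "a j \<in> \<rat> \<and> e * b j \<in> \<rat>" if "j \<in> J" for j using rat[OF that] by (simp add: e_def)
    show "a j ^ 2 + real d * (e * b j)^2 = 1" if "j \<in> J" for j
      using eq[OF that] by (simp add: De power_mult_distrib mult_ac)
  qed
  then obtain t s where "\<forall>j\<in>J. \<forall>i::int. 1/3 \<le> \<bar>t * a j + s * (e * b j) - of_int i\<bar>" by blast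
  then show ?thesis by (intro exI[of _ t] exI[of _ "s * e"]) (simp add: mult.assoc)
qed

section \<open>From directions in the plane to a rational conic\<close>

lemma half_far_from_int: "1/3 \<le> \<bar>(1/2 :: real) - of_int i\<bar>" "1/3 \<le> \<bar>- (1/2 :: real) - of_int i\<bar>"
  using fraction_far_from_int[of 2 1 1 i] fraction_far_from_int[of 2 1 "-1" i] by auto

text \<open>All sines in the hypotheses are integer multiples of \<open>1 / \<delta>\<close>, so
  their ratios are rational. With a third line among the directions this puts all of them on one
  rational conic; with at most two lines the form is chosen directly.\<close>

lemma commensurable_angles_character:
  fixes \<phi> :: "'a \<Rightarrow> real"
  assumes J: "finite J" and "\<delta> \<noteq> 0"
    and sin0: "\<And>j. j \<in> J \<Longrightarrow> sin (\<phi> j) * \<delta> \<in> \<int>"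
    and sin_diff_int: "\<And>i j. i \<in> J \<Longrightarrow> j \<in> J \<Longrightarrow> sin (\<phi> j - \<phi> i) * \<delta> \<in> \<int>"
  shows "\<exists>t s. \<forall>j\<in>J. \<forall>i::int. 1/3 \<le> \<bar>t * cos (\<phi> j) + s * sin (\<phi> j) - of_int i\<bar>"
proof -
  have sin_zero: "cos u = 1 \<or> cos u = -1" if "sin u = 0" for u :: real
    using that sin_cos_squared_add[of u] by (simp add: power2_eq_1_iff)
  show ?thesis
  proof (cases "\<exists>j\<in>J. sin (\<phi> j) \<noteq> 0")
    case False
    have "1/3 \<le> \<bar>1/2 * cos (\<phi> j) + 0 * sin (\<phi> j) - of_int i\<bar>" if "j \<in> J" for j and i :: int
      using False that sin_zero[of "\<phi> j"] half_far_from_int[of i] by auto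
    then show ?thesis by blast
  next
    case True
    then obtain k where k: "k \<in> J" "sin (\<phi> k) \<noteq> 0" by blast
    show ?thesis
    proof (cases "\<exists>j\<in>J. sin (\<phi> j) \<noteq> 0 \<and> sin (\<phi> j - \<phi> k) \<noteq> 0")
      case False
      \<comment> \<open>Solves \<open>1/2 * cos (\<phi> k) + s * sin (\<phi> k) = 1/2\<close>. Each
        direction is, up to sign, direction \<open>k\<close> or \<open>(1, 0)\<close>, so all values
        are 1/2 or -1/2.\<close>
      define s where "s = (1/2 - 1/2 * cos (\<phi> k)) / sin (\<phi> k)"
      have "1/3 \<le> \<bar>1/2 * cos (\<phi> j) + s * sin (\<phi> j) - of_int i\<bar>" if "j \<in> J" for j and i :: int
      proof (cases "sin (\<phi> j) = 0")
        case True
        then show ?thesis using sin_zero[of "\<phi> j"] half_far_from_int[of i] by auto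
      next
        case nz: False
        then have z: "sin (\<phi> j - \<phi> k) = 0" using False that by blast
        define c where "c = cos (\<phi> j - \<phi> k)"
        have c: "c = 1 \<or> c = -1" unfolding c_def using z by (rule sin_zero)
        have "cos (\<phi> j) = c * cos (\<phi> k)" "sin (\<phi> j) = c * sin (\<phi> k)"
          using cos_add[of "\<phi> j - \<phi> k" "\<phi> k"] sin_add[of "\<phi> j - \<phi> k" "\<phi> k"] z
          by (auto simp: c_def)
        then have "1/2 * cos (\<phi> j) + s * sin (\<phi> j) = c * (1/2)"
          using k by (simp add: s_def field_simps)
        then show ?thesis unfolding \<open>1/2 * cos (\<phi> j) + s * sin (\<phi> j) = c * (1/2)\<close>
          using c half_far_from_int[of i] by auto
      qed
      then show ?thesis by blast
    next
      case True
      then obtain l where l: "l \<in> J" "sin (\<phi> l) \<noteq> 0" "sin (\<phi> l - \<phi> k) \<noteq> 0" by blast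
      \<comment> \<open>Coordinates in an oblique basis: direction \<open>j\<close> is
        \<open>\<rho> j\<close> times direction \<open>k\<close> minus \<open>\<sigma> j\<close>
        times \<open>(1, 0)\<close>.\<close>
      define \<rho> where "\<rho> j = sin (\<phi> j) / sin (\<phi> k)" for j
      define \<sigma> where "\<sigma> j = sin (\<phi> j - \<phi> k) / sin (\<phi> k)" for j
      have rat: "\<rho> j \<in> \<rat>" "\<sigma> j \<in> \<rat>" if "j \<in> J" for j
      proof -
        have "\<rho> j = (sin (\<phi> j) * \<delta>) / (sin (\<phi> k) * \<delta>)"
          "\<sigma> j = (sin (\<phi> j - \<phi> k) * \<delta>) / (sin (\<phi> k) * \<delta>)"
          using assms(2) by (auto simp: \<rho>_def \<sigma>_def)
        then show "\<rho> j \<in> \<rat>" "\<sigma> j \<in> \<rat>"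
          using sin0[OF that] sin0[OF k(1)] sin_diff_int[OF k(1) that]
          by (metis Ints_subset_Rats Rats_divide subsetD)+
      qed
      have cos_eq: "cos (\<phi> j) = \<rho> j * cos (\<phi> k) - \<sigma> j" for j
        using k(2) by (simp add: \<rho>_def \<sigma>_def sin_diff field_simps)
      have sin_eq: "sin (\<phi> j) = \<rho> j * sin (\<phi> k)" for j
        using k(2) by (simp add: \<rho>_def)
      \<comment> \<open>The unit length of direction \<open>l\<close> gives a rational linear
        equation for \<open>cos (\<phi> k)\<close>. It is solvable because \<open>l\<close> lies on
        neither basis line.\<close>
      have "1 = (\<rho> l * cos (\<phi> k) - \<sigma> l)^2 + (\<rho> l * sin (\<phi> k))^2"
        using sin_cos_squared_add[of "\<phi> l"] cos_eq[of l] sin_eq[of l] by simp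
      also have "\<dots> = \<rho> l ^ 2 * (sin (\<phi> k) ^ 2 + cos (\<phi> k) ^ 2) - 2 * \<rho> l * \<sigma> l * cos (\<phi> k) + \<sigma> l ^ 2"
        by algebra
      finally have "2 * \<rho> l * \<sigma> l * cos (\<phi> k) = \<rho> l ^ 2 + \<sigma> l ^ 2 - 1" by simp
      moreover have "\<rho> l \<noteq> 0" "\<sigma> l \<noteq> 0" using l k by (auto simp: \<rho>_def \<sigma>_def)
      ultimately have "cos (\<phi> k) = (\<rho> l ^ 2 + \<sigma> l ^ 2 - 1) / (2 * \<rho> l * \<sigma> l)"
        by (simp add: field_simps)
      then have ck: "cos (\<phi> k) \<in> \<rat>" using rat[OF l(1)] by simp
      have "sin (\<phi> k) ^ 2 = 1 - cos (\<phi> k) ^ 2" by (rule sin_squared_eq)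
      then have "sin (\<phi> k) ^ 2 \<in> \<rat>" using ck by simp
      moreover have "sin (\<phi> k) ^ 2 > 0" using k by simp
      ultimately have "\<exists>t s. \<forall>j\<in>J. \<forall>i::int. 1/3 \<le> \<bar>t * cos (\<phi> j) + s * \<rho> j - of_int i\<bar>"
      proof (rule rational_conic_character[OF J])
        show "cos (\<phi> j) \<in> \<rat> \<and> \<rho> j \<in> \<rat>" if "j \<in> J" for j
          using rat[OF that] ck cos_eq[of j] by simp
        show "cos (\<phi> j) ^ 2 + sin (\<phi> k) ^ 2 * \<rho> j ^ 2 = 1" for j
          using sin_cos_squared_add[of "\<phi> j"] sin_eq[of j] by (simp add: power_mult_distrib mult_ac)
      qed
      then obtain t s where "\<forall>j\<in>J. \<forall>i::int. 1/3 \<le> \<bar>t * cos (\<phi> j) + s * \<rho> j - of_int i\<bar>"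
        by blast
      then show ?thesis
        by (intro exI[of _ t] exI[of _ "s / sin (\<phi> k)"]) (simp add: \<rho>_def)
    qed
  qed
qed

section \<open>Period-vectors and strips\<close>

lemma inner_unit_vec: "unit_vec t \<bullet> p = cos t * p $ 1 + sin t * p $ 2"
  by (simp add: unit_vec_def inner_vec_def sum_2)

lemma independent_pair_det:
  fixes v w :: "real ^ 2"
  assumes "v \<noteq> w" "independent {v, w}"
  shows "v $ 1 * w $ 2 - v $ 2 * w $ 1 \<noteq> 0"
proof
  assume det: "v $ 1 * w $ 2 - v $ 2 * w $ 1 = 0"
  have w: "w \<noteq> 0" using assms dependent_zero[of "{v, w}"] by auto
  have nspan: "v \<notin> span {w}" using assms by (auto simp: independent_insert)
  have "v = k *\<^sub>R w \<Longrightarrow> False" for k using nspan by (auto simp: span_singleton)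
  moreover have "v = (v $ 1 / w $ 1) *\<^sub>R w" if "w $ 1 \<noteq> 0"
    using that det by (simp add: vec_eq_iff forall_2 field_simps)
  moreover have "v = (v $ 2 / w $ 2) *\<^sub>R w" if "w $ 2 \<noteq> 0"
    using that det by (simp add: vec_eq_iff forall_2 field_simps)
  moreover have "w $ 1 \<noteq> 0 \<or> w $ 2 \<noteq> 0" using w by (auto simp: vec_eq_iff forall_2)
  ultimately show False by blast
qed

text \<open>Multiplicativity of the determinant: the sine is the determinant of the two unit
  vectors, and the right side is that of the matrix of inner products. For period-vectors it is an
  integer.\<close>

lemma sin_diff_inner_det:
  "sin (\<beta> - \<alpha>) * (v $ 1 * w $ 2 - v $ 2 * w $ 1) =
    (unit_vec \<alpha> \<bullet> v) * (unit_vec \<beta> \<bullet> w) - (unit_vec \<beta> \<bullet> v) * (unit_vec \<alpha> \<bullet> w)"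
  by (simp add: inner_unit_vec sin_diff algebra_simps)

text \<open>Rotation preserves inner products, so the one with \<open>unit_vec t\<close> recovers
  the first coordinate before rotation. Its distance to the closed set of integers is
  attained.\<close>

lemma rot_strips_near_int:
  assumes "p \<in> rot t ` strips \<epsilon>" "\<epsilon> < 1/3"
  shows "\<exists>i::int. \<bar>unit_vec t \<bullet> p - of_int i\<bar> < 1/3"
proof -
  obtain q where q: "p = rot t q" "dist_nearest_int (q $ 1) \<le> \<epsilon>"
    using assms(1) by (auto simp: strips_def)
  have "unit_vec t \<bullet> p = (sin t ^ 2 + cos t ^ 2) * q $ 1"
    unfolding q(1) by (simp add: inner_unit_vec rot_def power2_eq_square algebra_simps
        del: sin_cos_squared_add sin_cos_squared_add2 sin_cos_squared_add3)
  then have "unit_vec t \<bullet> p = q $ 1" by simp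
  moreover obtain z where "z \<in> \<int>" "infdist (q $ 1) \<int> = dist (q $ 1) z"
    using infdist_attains_inf[OF closed_Ints, of "q $ 1"] Ints_0 by blast
  moreover from this obtain i :: int where "z = of_int i" by (auto elim: Ints_cases)
  ultimately have "\<bar>unit_vec t \<bullet> p - of_int i\<bar> < 1/3"
    using q(2) assms(2) by (simp add: dist_nearest_int_def dist_real_def)
  then show ?thesis ..
qed

theorem theorem2p3:
  fixes \<epsilon> :: real and n :: nat and \<theta> :: "nat \<Rightarrow> real"
  assumes "0 < \<epsilon>" and "\<epsilon> < 1 / 3"
    and "\<forall>i\<in>{0..n}. \<forall>j\<in>{0..n}. i \<noteq> j \<longrightarrow> \<not> [\<theta> i = \<theta> j] (rmod (2 * pi))"
    and "periodic_strips n \<theta>"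
  shows "strips_union n \<theta> \<epsilon> \<noteq> UNIV"
proof -
  obtain v w where vw: "period_vector n \<theta> v" "period_vector n \<theta> w" "v \<noteq> w" "independent {v, w}"
    using assms(4) unfolding periodic_strips_def by blast
  define \<delta> where "\<delta> = v $ 1 * w $ 2 - v $ 2 * w $ 1"
  have "\<delta> \<noteq> 0" unfolding \<delta>_def using vw by (intro independent_pair_det)
  have int: "sin (\<theta> j - \<theta> i) * \<delta> \<in> \<int>" if "i \<in> {0..n}" "j \<in> {0..n}" for i j
    using vw(1,2) that unfolding \<delta>_def sin_diff_inner_det period_vector_def
    by (intro Ints_diff Ints_mult) auto
  \<comment> \<open>Measuring angles from \<open>\<theta> 0\<close> turns the first direction into
    \<open>(1, 0)\<close>; the sines required for single angles are then the differences with index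
    0.\<close>
  have "\<exists>t s. \<forall>j\<in>{0..n}. \<forall>i::int. 1/3 \<le> \<bar>t * cos (\<theta> j - \<theta> 0) + s * sin (\<theta> j - \<theta> 0) - of_int i\<bar>"
    using int by (intro commensurable_angles_character[OF _ \<open>\<delta> \<noteq> 0\<close>]) auto
  then obtain t s where ts:
    "\<And>j i. j \<in> {0..n} \<Longrightarrow> 1/3 \<le> \<bar>t * cos (\<theta> j - \<theta> 0) + s * sin (\<theta> j - \<theta> 0) - of_int i\<bar>"
    by blast
  \<comment> \<open>Rotating \<open>(t, s)\<close> back by \<open>\<theta> 0\<close> makes its inner
    products the values of the form found above.\<close>
  define p :: "real ^ 2" where "p = rot (\<theta> 0) (vector [t, s])"
  have inner_p: "unit_vec (\<theta> j) \<bullet> p = t * cos (\<theta> j - \<theta> 0) + s * sin (\<theta> j - \<theta> 0)" for j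
    by (simp add: p_def rot_def inner_unit_vec cos_diff sin_diff algebra_simps)
  have "p \<notin> strips_union n \<theta> \<epsilon>"
  proof
    assume "p \<in> strips_union n \<theta> \<epsilon>"
    then obtain j where j: "j \<in> {0..n}" "p \<in> rot (\<theta> j) ` strips \<epsilon>"
      unfolding strips_union_def by blast
    obtain i :: int where "\<bar>unit_vec (\<theta> j) \<bullet> p - of_int i\<bar> < 1/3"
      using rot_strips_near_int[OF j(2) assms(2)] by blast
    with ts[OF j(1), of i] inner_p show False by simp
  qed
  then show ?thesis by blast
qed

end
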